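(* Let $\mu$ be a partition with $\ell\ge1$ parts, let $d\ge0$, and let $\lambda=(\mu_1+d,\ldots,\mu_1+d,\mu_1+d,\mu_2+d,\ldots,\mu_\ell+d)$ (with $d$ initial parts equal to $\mu_1+d$). Then \[ \sum_{D\in\mathcal{E}(\lambda/\mu)}\ \prod_{(i,j)\in D}(x_i-y_j)=\det\bigl[A_{i,j}\bigr]_{i,j=1}^{d+\ell}, \] where \[ A_{i,j}=\begin{cases}\dfrac{(x_i-y_1)\cdots(x_i-y_{d+\ell-j})}{(x_i-x_{i+1})\cdots(x_i-x_{d+\ell})} & \text{if } j>\ell,\\[2mm] \dfrac{(x_i-y_1)\cdots(x_i-y_{\mu_j+d})}{(x_i-x_{i+1})\cdots(x_i-x_{d+j})} & \text{if } i-d\le j\le\ell,\\[2mm] 0 & \text{if } j<i-d,\end{cases} \] with empty products equal to $1$.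
   Context: $x_i,y_j$ are indeterminates. Excited diagrams $\mathcal{E}(\lambda/\mu)$: subsets of $[\lambda]$ obtained from $[\mu]$ by repeatedly replacing a cell $(i,j)\in D$ (row $i$, column $j$) by $(i+1,j+1)$ whenever $(i+1,j),(i,j+1),(i+1,j+1)$ lie in $[\lambda]\setminus D$. (In the paper the left side is phrased as the partition function of lozenge tilings with base $\mu$ and height $d$ (equivalently plane partitions of shape $\mu$ with entries at most $d$), where a horizontal lozenge at position $(i,j)$ has weight $x_i-y_j$; these tilings are in bijection with $\mathcal{E}(\lambda/\mu)$, cells of $D$ corresponding to horizontal lozenges at the same position.) *)

theory Defs
  imports "Jordan_Normal_Form.Determinant"
begin

text \<open>A partition is the list of its parts, which are positive and weakly decreasing. Rows,
  columns and the indices of the sequences \<open>x\<close>, \<open>y\<close> are counted from 1, lists from 0.\<close>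

definition is_partition :: "nat list \<Rightarrow> bool" where
  "is_partition \<mu> \<longleftrightarrow> sorted_wrt (\<ge>) \<mu> \<and> (\<forall>p \<in> set \<mu>. 0 < p)"

definition diagram :: "nat list \<Rightarrow> (nat \<times> nat) set" where
  "diagram \<mu> = {(i, j). 1 \<le> i \<and> i \<le> length \<mu> \<and> 1 \<le> j \<and> j \<le> \<mu> ! (i - 1)}"

inductive_set excited_diagrams :: "nat list \<Rightarrow> nat list \<Rightarrow> (nat \<times> nat) set set"
  for \<Lambda> \<mu> :: "nat list" where
  base: "diagram \<mu> \<in> excited_diagrams \<Lambda> \<mu>"
| excite: "insert (i + 1, j + 1) (D - {(i, j)}) \<in> excited_diagrams \<Lambda> \<mu>"
    if "D \<in> excited_diagrams \<Lambda> \<mu>" and "(i, j) \<in> D"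
      and "{(i + 1, j), (i, j + 1), (i + 1, j + 1)} \<subseteq> diagram \<Lambda> - D"

definition outer_shape :: "nat list \<Rightarrow> nat \<Rightarrow> nat list" where
  "outer_shape \<mu> d = replicate d (\<mu> ! 0 + d) @ map (\<lambda>p. p + d) \<mu>"

text \<open>The condition \<open>i \<le> j + d\<close> is \<open>i - d \<le> j\<close> without truncated subtraction. The indeterminates
  are rendered as arbitrary elements of an arbitrary field; the denominators do not vanish when
  \<open>x\<close> is injective on \<open>{1..d + l}\<close>. A field of rational functions is one instance.\<close>

definition A_entry ::
    "(nat \<Rightarrow> 'a::field) \<Rightarrow> (nat \<Rightarrow> 'a) \<Rightarrow> nat list \<Rightarrow> nat \<Rightarrow> nat \<Rightarrow> nat \<Rightarrow> 'a" where
  "A_entry x y \<mu> d i j =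
    (let l = length \<mu> in
     if j > l then
       (\<Prod>k = 1..d + l - j. x i - y k) / (\<Prod>k = i + 1..d + l. x i - x k)
     else if i \<le> j + d then
       (\<Prod>k = 1..\<mu> ! (j - 1) + d. x i - y k) / (\<Prod>k = i + 1..d + j. x i - x k)
     else 0)"

lemma finite_diagram: "finite (diagram \<mu>)"
proof -
  have "diagram \<mu> = (\<Union>i \<in> {1..length \<mu>}. {i} \<times> {1..\<mu> ! (i - 1)})"
    by (auto simp: diagram_def)
  then show ?thesis by simp
qed

lemma excited_diagrams_subset:
  "D \<in> excited_diagrams \<Lambda> \<mu> \<Longrightarrow> D \<subseteq> diagram \<mu> \<union> diagram \<Lambda>"
  by (induction rule: excited_diagrams.induct) auto

text \<open>Hence sums over \<open>excited_diagrams\<close> and products over its members are genuine finite ones.\<close>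

lemma finite_excited_diagrams: "finite (excited_diagrams \<Lambda> \<mu>)"
proof (rule finite_subset)
  show "excited_diagrams \<Lambda> \<mu> \<subseteq> Pow (diagram \<mu> \<union> diagram \<Lambda>)"
    using excited_diagrams_subset by blast
qed (simp add: finite_diagram)

lemma finite_excited_diagram: "D \<in> excited_diagrams \<Lambda> \<mu> \<Longrightarrow> finite D"
  by (meson excited_diagrams_subset finite_UnI finite_diagram finite_subset)

end

theory Submission imports Defs begin

text \<open>Moving the cell \<open>(i, j)\<close> of \<open>\<mu>\<close> down its diagonal by \<open>k (i, j)\<close> steps identifies the excited
  diagrams with the reverse plane partitions \<open>k\<close> of shape \<open>\<mu>\<close> with entries at most \<open>d\<close>. To induct,
  allow a separate bound \<open>c i\<close> in each row \<open>i\<close>; the matching determinant has in column \<open>j\<close> the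
  entries \<open>w (\<mu>\<^sub>j + c\<^sub>j) (j + c\<^sub>j)\<close>, where \<open>w a b\<close> is the vector with \<open>i\<close>-th coordinate
  \<open>(x\<^sub>i - y\<^sub>1) \<cdots> (x\<^sub>i - y\<^sub>a) / ((x\<^sub>i - x\<^sub>i\<^sub>+\<^sub>1) \<cdots> (x\<^sub>i - x\<^sub>b))\<close>, and 0 for \<open>i > b\<close>.

  Let \<open>r\<close> be the first descent of \<open>c\<close>. If \<open>\<mu>\<^sub>r > \<mu>\<^sub>r\<^sub>+\<^sub>1\<close>, the corner of row \<open>r\<close> either has
  an entry below \<open>c\<^sub>r\<close>, so that the bound may be lowered, or has the entry \<open>c\<^sub>r\<close> and can be removed; on the
  determinant side this is \<open>w (a + 1) b = w a (b - 1) + (x\<^sub>b - y\<^sub>a\<^sub>+\<^sub>1) w a b\<close> applied to column \<open>r\<close>.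
  If \<open>\<mu>\<^sub>r = \<mu>\<^sub>r\<^sub>+\<^sub>1\<close>, row \<open>r + 1\<close> already forces the lower bound on row \<open>r\<close>, while the second term
  of the recurrence is column \<open>r + 1\<close>. Without a descent \<open>c = 0\<close>, and the matrix is triangular.\<close>

section \<open>Reverse plane partitions with row bounds\<close>

definition cells :: "nat \<Rightarrow> (nat \<Rightarrow> nat) \<Rightarrow> (nat \<times> nat) set" where
  "cells n m = {(i, j). 1 \<le> i \<and> i \<le> n \<and> 1 \<le> j \<and> j \<le> m i}"

definition row_decreasing :: "nat \<Rightarrow> (nat \<Rightarrow> nat) \<Rightarrow> bool" where
  "row_decreasing n m \<longleftrightarrow> (\<forall>i i'. 1 \<le> i \<longrightarrow> i \<le> i' \<longrightarrow> i' \<le> n \<longrightarrow> m i' \<le> m i)"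

text \<open>Entries off the shape are fixed to 0, so that functions and fillings correspond one to
  one.\<close>

definition bounded_rpp :: "nat \<Rightarrow> (nat \<Rightarrow> nat) \<Rightarrow> (nat \<Rightarrow> nat) \<Rightarrow> (nat \<times> nat \<Rightarrow> nat) set" where
  "bounded_rpp n m c = {k.
     (\<forall>p. p \<notin> cells n m \<longrightarrow> k p = 0) \<and>
     (\<forall>i j i' j'. (i, j) \<in> cells n m \<longrightarrow> (i', j') \<in> cells n m \<longrightarrow> i \<le> i' \<longrightarrow> j \<le> j' \<longrightarrow>
        k (i, j) \<le> k (i', j')) \<and>
     (\<forall>i j. (i, j) \<in> cells n m \<longrightarrow> k (i, j) \<le> c i)}"

definition rpp_weight ::
    "(nat \<Rightarrow> 'a::comm_ring_1) \<Rightarrow> (nat \<Rightarrow> 'a) \<Rightarrow> (nat \<times> nat) set \<Rightarrow> (nat \<times> nat \<Rightarrow> nat) \<Rightarrow> 'a" where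
  "rpp_weight x y C k = (\<Prod>(i, j) \<in> C. x (i + k (i, j)) - y (j + k (i, j)))"

definition rpp_sum ::
    "(nat \<Rightarrow> 'a::comm_ring_1) \<Rightarrow> (nat \<Rightarrow> 'a) \<Rightarrow> nat \<Rightarrow> (nat \<Rightarrow> nat) \<Rightarrow> (nat \<Rightarrow> nat) \<Rightarrow> 'a" where
  "rpp_sum x y n m c = (\<Sum>k \<in> bounded_rpp n m c. rpp_weight x y (cells n m) k)"

definition flag_entry :: "(nat \<Rightarrow> 'a::field) \<Rightarrow> (nat \<Rightarrow> 'a) \<Rightarrow> nat \<Rightarrow> nat \<Rightarrow> nat \<Rightarrow> 'a" where
  "flag_entry x y a b i =
     (if i \<le> b then (\<Prod>k = 1..a. x i - y k) / (\<Prod>k = i + 1..b. x i - x k) else 0)"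

definition flag_det ::
    "(nat \<Rightarrow> 'a::field) \<Rightarrow> (nat \<Rightarrow> 'a) \<Rightarrow> nat \<Rightarrow> (nat \<Rightarrow> nat) \<Rightarrow> (nat \<Rightarrow> nat) \<Rightarrow> 'a" where
  "flag_det x y n m c = det (mat n n (\<lambda>(i, j).
     flag_entry x y (m (Suc j) + c (Suc j)) (Suc j + c (Suc j)) (Suc i)))"

lemma finite_cells: "finite (cells n m)"
proof -
  have "cells n m = (\<Union>i \<in> {1..n}. {i} \<times> {1..m i})"
    by (auto simp: cells_def)
  then show ?thesis by simp
qed

lemma row_decreasingD: "row_decreasing n m \<Longrightarrow> 1 \<le> i \<Longrightarrow> i \<le> i' \<Longrightarrow> i' \<le> n \<Longrightarrow> m i' \<le> m i"
  unfolding row_decreasing_def by blast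

lemma cells_down_closed:
  assumes "row_decreasing n m" "(i', j') \<in> cells n m" "1 \<le> i" "i \<le> i'" "1 \<le> j" "j \<le> j'"
  shows "(i, j) \<in> cells n m"
  using assms row_decreasingD[OF assms(1), of i i'] by (auto simp: cells_def)

lemma bounded_rpp_outside: "k \<in> bounded_rpp n m c \<Longrightarrow> p \<notin> cells n m \<Longrightarrow> k p = 0"
  by (cases p) (simp add: bounded_rpp_def)

lemma bounded_rpp_mono:
  "k \<in> bounded_rpp n m c \<Longrightarrow> (i, j) \<in> cells n m \<Longrightarrow> (i', j') \<in> cells n m \<Longrightarrow> i \<le> i' \<Longrightarrow> j \<le> j' \<Longrightarrow>
    k (i, j) \<le> k (i', j')"
  unfolding bounded_rpp_def by blast

lemma bounded_rpp_le: "k \<in> bounded_rpp n m c \<Longrightarrow> (i, j) \<in> cells n m \<Longrightarrow> k (i, j) \<le> c i"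
  unfolding bounded_rpp_def by blast

lemma bounded_rppI:
  assumes "\<And>p. p \<notin> cells n m \<Longrightarrow> k p = 0"
    and "\<And>i j i' j'. (i, j) \<in> cells n m \<Longrightarrow> (i', j') \<in> cells n m \<Longrightarrow> i \<le> i' \<Longrightarrow> j \<le> j' \<Longrightarrow>
        k (i, j) \<le> k (i', j')"
    and "\<And>i j. (i, j) \<in> cells n m \<Longrightarrow> k (i, j) \<le> c i"
  shows "k \<in> bounded_rpp n m c"
  by (simp add: bounded_rpp_def assms)

lemma finite_bounded_rpp: "finite (bounded_rpp n m c)"
proof (rule finite_subset)
  let ?B = "{..(\<Sum>i = 1..n. c i)}"
  show "bounded_rpp n m c \<subseteq>
      {k. \<forall>p. (p \<in> cells n m \<longrightarrow> k p \<in> ?B) \<and> (p \<notin> cells n m \<longrightarrow> k p = 0)}"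
  proof (intro subsetI CollectI allI conjI impI)
    fix k p assume k: "k \<in> bounded_rpp n m c" and p: "p \<in> cells n m"
    obtain i j where ij: "p = (i, j)" by force
    have "k p \<le> c i" using bounded_rpp_le[OF k] p ij by blast
    also have "c i \<le> (\<Sum>i = 1..n. c i)"
      using p ij by (intro member_le_sum) (auto simp: cells_def)
    finally show "k p \<in> ?B" by simp
  qed (rule bounded_rpp_outside)
qed (rule finite_set_of_finite_funs, simp_all add: finite_cells)

text \<open>Each cell of row \<open>r\<close> has a cell of row \<open>Suc r\<close> below it, whose
  entry is at most \<open>c (Suc r) = c r - 1\<close>.\<close>

lemma bounded_rpp_tighten:
  assumes r: "1 \<le> r" "r < n" and eq: "m r = m (Suc r)"
    and c: "c r = Suc (c (Suc r))"
  shows "bounded_rpp n m c = bounded_rpp n m (c(r := c r - 1))" (is "?L = ?R")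
proof
  show "?L \<subseteq> ?R"
  proof
    fix k assume k: "k \<in> ?L"
    show "k \<in> ?R"
    proof (rule bounded_rppI)
      fix i j assume ij: "(i, j) \<in> cells n m"
      show "k (i, j) \<le> (c(r := c r - 1)) i"
      proof (cases "i = r")
        case True
        with ij r eq have *: "(Suc r, j) \<in> cells n m" by (auto simp: cells_def)
        have "k (i, j) \<le> k (Suc r, j)" using bounded_rpp_mono[OF k ij *] True by simp
        also have "\<dots> \<le> c (Suc r)" by (rule bounded_rpp_le[OF k *])
        finally show ?thesis using c True by simp
      qed (use bounded_rpp_le[OF k ij] in simp)
    qed (use bounded_rpp_outside[OF k] bounded_rpp_mono[OF k] in auto)
  qed
  show "?R \<subseteq> ?L"
  proof
    fix k assume k: "k \<in> ?R"
    show "k \<in> ?L"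
    proof (rule bounded_rppI)
      fix i j assume ij: "(i, j) \<in> cells n m"
      show "k (i, j) \<le> c i" using bounded_rpp_le[OF k ij] by (auto split: if_splits)
    qed (use bounded_rpp_outside[OF k] bounded_rpp_mono[OF k] in auto)
  qed
qed

lemma cells_remove_corner:
  assumes "1 \<le> r" "r \<le> n" "1 \<le> m r"
  shows "cells n m = insert (r, m r) (cells n (m(r := m r - 1)))"
    and "(r, m r) \<notin> cells n (m(r := m r - 1))"
  using assms by (auto simp: cells_def fun_upd_def split: if_splits)

text \<open>The last entry of row \<open>r\<close> is the largest of its row: either it is below
  \<open>c r\<close>, and then so is the whole row, or it equals \<open>c r\<close> and its cell is
  cut off. The condition on \<open>c (r - 1)\<close> allows this cell to be glued back without
  breaking monotonicity.\<close>

lemma bounded_rpp_split: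
  assumes m: "row_decreasing n m" and r: "1 \<le> r" "r < n" and corner: "m (Suc r) < m r"
    and c: "1 \<le> c r" and c': "1 < r \<Longrightarrow> c (r - 1) \<le> c r"
  defines "c' \<equiv> c(r := c r - 1)" and "m' \<equiv> m(r := m r - 1)"
  shows "bounded_rpp n m c =
    bounded_rpp n m c' \<union> (\<lambda>k. k((r, m r) := c r)) ` bounded_rpp n m' c" (is "?L = ?A \<union> ?B")
proof
  have C: "cells n m = insert (r, m r) (cells n m')" "(r, m r) \<notin> cells n m'"
    unfolding m'_def using cells_remove_corner[of r n m] r corner by auto
  \<comment> \<open>No other cell lies weakly southeast of the corner, so a large entry there
    constrains nothing.\<close>
  have corner_max: "i = r \<and> j = m r" if "(i, j) \<in> cells n m" "r \<le> i" "m r \<le> j" for i j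
  proof -
    have "i = r"
    proof (rule ccontr)
      assume "i \<noteq> r"
      then have "m i \<le> m (Suc r)" using row_decreasingD[OF m, of "Suc r" i] that r
        by (auto simp: cells_def)
      then show False using that corner by (auto simp: cells_def)
    qed
    then show ?thesis using that by (auto simp: cells_def)
  qed
  show "?L \<subseteq> ?A \<union> ?B"
  proof
    fix k assume k: "k \<in> ?L"
    show "k \<in> ?A \<union> ?B"
    proof (cases "k (r, m r) = c r")
      case True
      \<comment> \<open>The corner leaves the shape, so its entry is reset to the default 0.\<close>
      have "k((r, m r) := 0) \<in> bounded_rpp n m' c"
      proof (rule bounded_rppI)
        fix p assume "p \<notin> cells n m'"
        then show "(k((r, m r) := 0)) p = 0" using bounded_rpp_outside[OF k, of p] C by auto
      next
        fix i j i' j' assume "(i, j) \<in> cells n m'" "(i', j') \<in> cells n m'" "i \<le> i'" "j \<le> j'"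
        then show "(k((r, m r) := 0)) (i, j) \<le> (k((r, m r) := 0)) (i', j')"
          using bounded_rpp_mono[OF k, of i j i' j'] C by auto
      next
        fix i j assume "(i, j) \<in> cells n m'"
        then show "(k((r, m r) := 0)) (i, j) \<le> c i"
          using bounded_rpp_le[OF k, of i j] C by auto
      qed
      moreover have "k = (k((r, m r) := 0))((r, m r) := c r)" using True by auto
      ultimately show ?thesis by blast
    next
      case False
      have "k \<in> ?A"
      proof (rule bounded_rppI)
        fix i j assume ij: "(i, j) \<in> cells n m"
        show "k (i, j) \<le> c' i"
        proof (cases "i = r")
          case True
          have "k (i, j) \<le> k (r, m r)"
            using bounded_rpp_mono[OF k ij, of r "m r"] C True ij by (auto simp: cells_def)
          also have "\<dots> \<le> c r - 1"
            using bounded_rpp_le[OF k, of r "m r"] C False by auto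
          finally show ?thesis using True by (simp add: c'_def)
        qed (use bounded_rpp_le[OF k ij] in \<open>simp add: c'_def\<close>)
      qed (use bounded_rpp_outside[OF k] bounded_rpp_mono[OF k] in auto)
      then show ?thesis ..
    qed
  qed
  show "?A \<union> ?B \<subseteq> ?L"
  proof (intro Un_least subsetI)
    fix k assume k: "k \<in> ?A"
    show "k \<in> ?L"
    proof (rule bounded_rppI)
      fix i j assume ij: "(i, j) \<in> cells n m"
      show "k (i, j) \<le> c i"
        using bounded_rpp_le[OF k ij] by (auto simp: c'_def split: if_splits)
    qed (use bounded_rpp_outside[OF k] bounded_rpp_mono[OF k] in auto)
  next
    fix k assume "k \<in> ?B"
    then obtain h where h: "h \<in> bounded_rpp n m' c" and k: "k = h((r, m r) := c r)" by blast
    have kr: "k (r, m r) = c r" using k by simp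
    have kh: "k p = h p" if "p \<in> cells n m'" for p using that C k by auto
    have below: "k (i, j) \<le> c r" if ij: "(i, j) \<in> cells n m" "i \<le> r" "j \<le> m r" for i j
    proof (cases "i = r")
      case True
      show ?thesis
      proof (cases "j = m r")
        case False
        then have "(i, j) \<in> cells n m'" using ij C by auto
        then show ?thesis using bounded_rpp_le[OF h] kh True by auto
      qed (use True kr in simp)
    next
      case False
      then have r1: "1 < r" "i \<le> r - 1" using ij by (auto simp: cells_def)
      \<comment> \<open>Rows further up may have bounds above \<open>c r\<close>, so the comparison
        passes through row \<open>r - 1\<close>.\<close>
      have "(r - 1, j) \<in> cells n m"
        by (rule cells_down_closed[OF m, of r "m r"]) (use C r1 ij in \<open>auto simp: cells_def\<close>)
      then have p: "(r - 1, j) \<in> cells n m'" "(i, j) \<in> cells n m'"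
        unfolding C(1) using ij(1) C(1) r1 False by auto
      have "h (i, j) \<le> h (r - 1, j)" using bounded_rpp_mono[OF h p(2,1)] r1 by simp
      also have "\<dots> \<le> c (r - 1)" by (rule bounded_rpp_le[OF h p(1)])
      finally show ?thesis using c' r1 kh p by simp
    qed
    show "k \<in> ?L"
    proof (rule bounded_rppI)
      fix p assume "p \<notin> cells n m"
      then show "k p = 0" using bounded_rpp_outside[OF h, of p] C k by auto
    next
      fix i j i' j' assume ij: "(i, j) \<in> cells n m" "(i', j') \<in> cells n m" "i \<le> i'" "j \<le> j'"
      consider "(i', j') = (r, m r)" | "(i, j) = (r, m r)" | "(i, j) \<in> cells n m'" "(i', j') \<in> cells n m'"
        using ij C by blast
      then show "k (i, j) \<le> k (i', j')"
      proof cases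
        case 1
        then show ?thesis using below[of i j] ij kr by simp
      next
        case 2
        then show ?thesis using corner_max[of i' j'] ij by simp
      next
        case 3
        then show ?thesis using bounded_rpp_mono[OF h 3] ij kh by simp
      qed
    next
      fix i j assume ij: "(i, j) \<in> cells n m"
      then consider "(i, j) = (r, m r)" | "(i, j) \<in> cells n m'" using C by blast
      then show "k (i, j) \<le> c i"
        by cases (use kr bounded_rpp_le[OF h] kh in auto)
    qed
  qed
qed

text \<open>A corner with entry \<open>c r\<close> is moved to \<open>(r + c r, m r + c r)\<close>,
  which accounts for the factor. The corner entry also tells the two parts of the split
  apart.\<close>

lemma rpp_sum_split:
  fixes x y :: "nat \<Rightarrow> 'a::comm_ring_1"
  assumes m: "row_decreasing n m" and r: "1 \<le> r" "r < n" and corner: "m (Suc r) < m r"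
    and c: "1 \<le> c r" and c': "1 < r \<Longrightarrow> c (r - 1) \<le> c r"
  shows "rpp_sum x y n m c = rpp_sum x y n m (c(r := c r - 1))
    + (x (r + c r) - y (m r + c r)) * rpp_sum x y n (m(r := m r - 1)) c"
proof -
  let ?c' = "c(r := c r - 1)" and ?m' = "m(r := m r - 1)"
  let ?f = "\<lambda>k. k((r, m r) := c r)"
  have C: "cells n m = insert (r, m r) (cells n ?m')" "(r, m r) \<notin> cells n ?m'"
    using cells_remove_corner[of r n m] r corner by auto
  have disj: "bounded_rpp n m ?c' \<inter> ?f ` bounded_rpp n ?m' c = {}"
  proof (intro equals0I, elim IntE)
    fix k assume "k \<in> bounded_rpp n m ?c'" "k \<in> ?f ` bounded_rpp n ?m' c"
    then show False using bounded_rpp_le[of k n m ?c' r "m r"] C c by fastforce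
  qed
  have inj: "inj_on ?f (bounded_rpp n ?m' c)"
  proof (rule inj_onI)
    fix k h assume k: "k \<in> bounded_rpp n ?m' c" and h: "h \<in> bounded_rpp n ?m' c"
      and eq: "?f k = ?f h"
    show "k = h"
    proof
      fix p
      show "k p = h p"
        using fun_cong[OF eq, of p] bounded_rpp_outside[OF k C(2)] bounded_rpp_outside[OF h C(2)]
        by (cases "p = (r, m r)") auto
    qed
  qed
  have w: "rpp_weight x y (cells n m) (?f k)
      = (x (r + c r) - y (m r + c r)) * rpp_weight x y (cells n ?m') k" for k
  proof -
    have "(\<Prod>(i, j) \<in> cells n ?m'. x (i + ?f k (i, j)) - y (j + ?f k (i, j)))
        = (\<Prod>(i, j) \<in> cells n ?m'. x (i + k (i, j)) - y (j + k (i, j)))"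
      using C(2) by (intro prod.cong) auto
    then show ?thesis
      unfolding rpp_weight_def C(1) using C(2) by (simp add: finite_cells)
  qed
  have "rpp_sum x y n m c =
      (\<Sum>k \<in> bounded_rpp n m ?c' \<union> ?f ` bounded_rpp n ?m' c. rpp_weight x y (cells n m) k)"
    unfolding rpp_sum_def by (subst bounded_rpp_split[OF assms]) auto
  also have "\<dots> = rpp_sum x y n m ?c' + (\<Sum>k \<in> ?f ` bounded_rpp n ?m' c. rpp_weight x y (cells n m) k)"
    unfolding rpp_sum_def by (rule sum.union_disjoint) (use disj finite_bounded_rpp in auto)
  also have "(\<Sum>k \<in> ?f ` bounded_rpp n ?m' c. rpp_weight x y (cells n m) k)
      = (\<Sum>k \<in> bounded_rpp n ?m' c. rpp_weight x y (cells n m) (?f k))"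
    by (simp only: sum.reindex[OF inj] o_def)
  also have "\<dots> = (x (r + c r) - y (m r + c r)) * rpp_sum x y n ?m' c"
    by (simp only: w rpp_sum_def sum_distrib_left)
  finally show ?thesis .
qed

section \<open>The determinant\<close>

text \<open>Write \<open>x i - y (Suc a)\<close> as
  \<open>(x i - x (Suc b)) + (x (Suc b) - y (Suc a))\<close>; the first summand cancels the last
  factor of the denominator. For \<open>i = Suc b\<close> this summand is 0, in agreement with the
  default value of \<open>flag_entry x y a b i\<close>.\<close>

lemma flag_entry_step:
  fixes x y :: "nat \<Rightarrow> 'a::field"
  assumes inj: "inj_on x {1..n}" and i: "1 \<le> i" and b: "b < n"
  shows "flag_entry x y (Suc a) (Suc b) i
    = flag_entry x y a b i + (x (Suc b) - y (Suc a)) * flag_entry x y a (Suc b) i"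
proof -
  consider "i \<le> b" | "i = Suc b" | "Suc b < i" by linarith
  then show ?thesis
  proof cases
    case 1
    have ne: "x i - x (Suc b) \<noteq> 0"
      using inj_onD[OF inj, of i "Suc b"] i b 1 by auto
    have "(\<Prod>k = i + 1..Suc b. x i - x k) = (\<Prod>k = i + 1..b. x i - x k) * (x i - x (Suc b))"
      using 1 by (simp add: prod.nat_ivl_Suc')
    \<comment> \<open>For \<open>q = 0\<close> all quotients are 0 by the convention on
      division.\<close>
    moreover have "p * (x i - y (Suc a)) / (q * (x i - x (Suc b)))
        = p / q + (x (Suc b) - y (Suc a)) * (p / (q * (x i - x (Suc b))))" for p q
      using ne by (cases "q = 0") (simp_all add: divide_simps, simp add: algebra_simps)
    ultimately show ?thesis using 1 by (simp add: flag_entry_def)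
  qed (auto simp: flag_entry_def)
qed

text \<open>Linearity in column \<open>r\<close>: Laplace expansion along it uses cofactors that do
  not see this column and hence agree for all three matrices.\<close>

lemma det_column_add:
  fixes f g h :: "nat \<Rightarrow> nat \<Rightarrow> 'a::comm_ring_1"
  assumes r: "r < n"
    and col: "\<And>i. i < n \<Longrightarrow> f i r = g i r + z * h i r"
    and g: "\<And>i j. i < n \<Longrightarrow> j < n \<Longrightarrow> j \<noteq> r \<Longrightarrow> g i j = f i j"
    and h: "\<And>i j. i < n \<Longrightarrow> j < n \<Longrightarrow> j \<noteq> r \<Longrightarrow> h i j = f i j"
  shows "det (mat n n (\<lambda>(i, j). f i j))
    = det (mat n n (\<lambda>(i, j). g i j)) + z * det (mat n n (\<lambda>(i, j). h i j))"
proof -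
  let ?F = "mat n n (\<lambda>(i, j). f i j)" and ?G = "mat n n (\<lambda>(i, j). g i j)"
    and ?H = "mat n n (\<lambda>(i, j). h i j)"
  have G: "cofactor ?G i r = cofactor ?F i r" if "i < n" for i
    unfolding cofactor_def mat_delete_def using g r that
    by (intro arg_cong2[where f = "(*)"] arg_cong[where f = det] refl eq_matI) auto
  have H: "cofactor ?H i r = cofactor ?F i r" if "i < n" for i
    unfolding cofactor_def mat_delete_def using h r that
    by (intro arg_cong2[where f = "(*)"] arg_cong[where f = det] refl eq_matI) auto
  show ?thesis
    using r by (simp add: laplace_expansion_column[where n = n and j = r] G H col
        sum_distrib_left sum.distrib algebra_simps)
qed


text \<open>In column \<open>r\<close>, lowering \<open>c r\<close> decreases both parameters of
  \<open>flag_entry\<close>, lowering \<open>m r\<close> only the first; these are the two terms of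
  \<open>flag_entry_step\<close>.\<close>

lemma flag_det_split:
  fixes x y :: "nat \<Rightarrow> 'a::field"
  assumes inj: "inj_on x {1..n}" and r: "1 \<le> r" and rc: "r + c r \<le> n" and c: "1 \<le> c r" and m: "1 \<le> m r"
  shows "flag_det x y n m c = flag_det x y n m (c(r := c r - 1))
    + (x (r + c r) - y (m r + c r)) * flag_det x y n (m(r := m r - 1)) c"
  unfolding flag_det_def
proof (rule det_column_add[where r = "r - 1"])
  show "r - 1 < n" using r rc c by simp
  fix i
  show "flag_entry x y (m (Suc (r - 1)) + c (Suc (r - 1))) (Suc (r - 1) + c (Suc (r - 1))) (Suc i) =
       flag_entry x y (m (Suc (r - 1)) + (c(r := c r - 1)) (Suc (r - 1)))
        (Suc (r - 1) + (c(r := c r - 1)) (Suc (r - 1))) (Suc i) +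
       (x (r + c r) - y (m r + c r)) *
       flag_entry x y ((m(r := m r - 1)) (Suc (r - 1)) + c (Suc (r - 1)))
        (Suc (r - 1) + c (Suc (r - 1))) (Suc i)"
    using flag_entry_step[OF inj, of "Suc i" "r + c r - 1" y "m r + c r - 1"] r rc c m by simp
qed auto

text \<open>The second term of the recurrence is now column \<open>Suc r\<close>, because
  \<open>m r + c r - 1 = m (Suc r) + c (Suc r)\<close> and
  \<open>r + c r = Suc r + c (Suc r)\<close>. Its determinant has two equal columns.\<close>

lemma flag_det_tighten:
  fixes x y :: "nat \<Rightarrow> 'a::field"
  assumes inj: "inj_on x {1..n}" and r: "1 \<le> r" "r < n" and rc: "r + c r \<le> n"
    and c: "c r = Suc (c (Suc r))" and m: "m r = m (Suc r)"
  shows "flag_det x y n m c = flag_det x y n m (c(r := c r - 1))"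
proof -
  define f where "f i j = flag_entry x y (m (Suc j) + c (Suc j)) (Suc j + c (Suc j)) (Suc i)" for i j
  define h where "h i j = (if j = r - 1 then f i r else f i j)" for i j
  let ?z = "x (r + c r) - y (m r + c r)"
  have "flag_det x y n m c = flag_det x y n m (c(r := c r - 1)) + ?z * det (mat n n (\<lambda>(i, j). h i j))"
    unfolding flag_det_def
  proof (rule det_column_add[where r = "r - 1"])
    show "r - 1 < n" using r by simp
    fix i
    show "flag_entry x y (m (Suc (r - 1)) + c (Suc (r - 1))) (Suc (r - 1) + c (Suc (r - 1))) (Suc i) =
       flag_entry x y (m (Suc (r - 1)) + (c(r := c r - 1)) (Suc (r - 1)))
        (Suc (r - 1) + (c(r := c r - 1)) (Suc (r - 1))) (Suc i) +
       ?z * h i (r - 1)"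
      using flag_entry_step[OF inj, of "Suc i" "r + c r - 1" y "m r + c r - 1"] r rc c m
      by (simp add: h_def f_def)
  qed (auto simp: h_def f_def)
  also have "det (mat n n (\<lambda>(i, j). h i j)) = 0"
    by (rule det_identical_columns[of _ n "r - 1" r]) (use r in \<open>auto simp: h_def\<close>)
  finally show ?thesis by (simp only: mult_zero_right add_0_right)
qed

section \<open>Equality of the sum and the determinant\<close>

lemma flag_det_diagonal:
  assumes c: "\<And>i. 1 \<le> i \<Longrightarrow> i \<le> n \<Longrightarrow> c i = 0"
  shows "flag_det x y n m c = (\<Prod>i = 1..n. \<Prod>j = 1..m i. x i - y j)"
proof -
  let ?A = "mat n n (\<lambda>(i, j). flag_entry x y (m (Suc j) + c (Suc j)) (Suc j + c (Suc j)) (Suc i))"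
  \<comment> \<open>For \<open>c = 0\<close> column \<open>j\<close>, counted from 1, is
    \<open>flag_entry x y (m j) j\<close>: zero below the diagonal, with empty denominator on
    it.\<close>
  have "det ?A = prod_list (diag_mat ?A)"
    by (rule det_upper_triangular) (auto simp: upper_triangular_def flag_entry_def c)
  also have "\<dots> = (\<Prod>i<n. ?A $$ (i, i))"
    by (simp add: prod_list_diag_prod atLeast0LessThan)
  also have "\<dots> = (\<Prod>i<n. \<Prod>j = 1..m (Suc i). x (Suc i) - y j)"
    by (intro prod.cong) (auto simp: flag_entry_def c)
  also have "\<dots> = (\<Prod>i = 1..n. \<Prod>j = 1..m i. x i - y j)"
    by (rule prod.reindex_bij_witness[of _ "\<lambda>i. i - 1" Suc]) auto
  finally show ?thesis unfolding flag_det_def .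
qed

lemma rpp_sum_zero_bound:
  assumes c: "\<And>i. 1 \<le> i \<Longrightarrow> i \<le> n \<Longrightarrow> c i = 0"
  shows "rpp_sum x y n m c = (\<Prod>i = 1..n. \<Prod>j = 1..m i. x i - y j)"
proof -
  have "bounded_rpp n m c = {\<lambda>p. 0}"
  proof (intro equalityI subsetI)
    fix k assume k: "k \<in> bounded_rpp n m c"
    have "k p = 0" for p
    proof (cases "p \<in> cells n m")
      case True
      then show ?thesis using bounded_rpp_le[OF k, of "fst p" "snd p"] c by (auto simp: cells_def)
    qed (rule bounded_rpp_outside[OF k])
    then show "k \<in> {\<lambda>p. 0}" by auto
  qed (auto intro!: bounded_rppI)
  then have "rpp_sum x y n m c = (\<Prod>(i, j) \<in> cells n m. x i - y j)"
    by (simp add: rpp_sum_def rpp_weight_def)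
  also have "cells n m = (SIGMA i:{1..n}. {1..m i})"
    by (auto simp: cells_def)
  finally show ?thesis by (simp add: prod.Sigma)
qed

text \<open>The conditions on \<open>c\<close> say that \<open>i + c i\<close> increases weakly up
  to \<open>n\<close>. They keep all denominators in the range where \<open>x\<close> is injective,
  force descents to have size one, and survive lowering \<open>c\<close> at its first
  descent.\<close>

lemma rpp_sum_eq_flag_det:
  fixes x y :: "nat \<Rightarrow> 'a::field"
  assumes inj: "inj_on x {1..n}" and m: "row_decreasing n m"
    and c: "\<And>i. 1 \<le> i \<Longrightarrow> i < n \<Longrightarrow> c i \<le> Suc (c (Suc i))" and cn: "c n = 0"
  shows "rpp_sum x y n m c = flag_det x y n m c"
  using m c cn
proof (induction "(\<Sum>i = 1..n. m i) + (\<Sum>i = 1..n. c i)" arbitrary: m c rule: less_induct)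
  case (less m c)
  note m = less.prems(1) and c = less.prems(2) and cn = less.prems(3)
  have flag: "i + c i \<le> n" if "i \<le> n" "1 \<le> i" for i
    using that
  proof (induction rule: inc_induct)
    case (step i)
    then show ?case using c[of i] by simp
  qed (simp add: cn)
  show ?case
  proof (cases "\<exists>r. 1 \<le> r \<and> r < n \<and> c (Suc r) < c r")
    case False
    have "c i = 0" if "i \<le> n" "1 \<le> i" for i
      using that
    proof (induction rule: inc_induct)
      case (step i)
      then show ?case using False by (metis One_nat_def Suc_leI le_SucI le_zero_eq not_le)
    qed (simp add: cn)
    then show ?thesis by (simp add: rpp_sum_zero_bound flag_det_diagonal)
  next
    case True
    define r where "r = (LEAST r. 1 \<le> r \<and> r < n \<and> c (Suc r) < c r)"
    have r: "1 \<le> r" "r < n" "c (Suc r) < c r"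
      using LeastI_ex[OF True] unfolding r_def by auto
    \<comment> \<open>By minimality \<open>r - 1\<close> is no descent. Hence the condition at
      \<open>r - 1\<close> survives lowering \<open>c r\<close>, and a corner of row
      \<open>r\<close> can be split off.\<close>
    have pre: "c (r - 1) \<le> c r" if "1 < r"
    proof (rule ccontr)
      assume "\<not> ?thesis"
      then have "1 \<le> r - 1 \<and> r - 1 < n \<and> c (Suc (r - 1)) < c (r - 1)" using that r by auto
      then have "r \<le> r - 1" unfolding r_def by (rule Least_le)
      then show False using r by simp
    qed
    have cr: "c r = Suc (c (Suc r))" using c[of r] r by simp
    have rc: "r + c r \<le> n" using flag[of r] r by simp
    let ?c' = "c(r := c r - 1)" and ?m' = "m(r := m r - 1)"
    have c_less: "(\<Sum>i = 1..n. ?c' i) < (\<Sum>i = 1..n. c i)"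
      by (rule sum_strict_mono_ex1) (use r cr in auto)
    have c'1: "?c' i \<le> Suc (?c' (Suc i))" if "1 \<le> i" "i < n" for i
      using c[OF that] pre that by (cases "Suc i = r") auto
    have c'2: "?c' n = 0" using cn r by simp
    have IH1: "rpp_sum x y n m ?c' = flag_det x y n m ?c'"
      using c_less by (intro less.hyps m c'1 c'2) simp
    show ?thesis
    proof (cases "m r = m (Suc r)")
      case True
      then show ?thesis
        using IH1 flag_det_tighten[OF inj r(1,2) rc cr True, of y]
          bounded_rpp_tighten[OF r(1,2) True cr] by (simp add: rpp_sum_def)
    next
      case False
      then have corner: "m (Suc r) < m r" using row_decreasingD[OF m, of r "Suc r"] r by simp
      have m': "row_decreasing n ?m'"
        unfolding row_decreasing_def
      proof (intro allI impI)
        fix i i' assume i: "1 \<le> i" "i \<le> i'" "i' \<le> n"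
        show "?m' i' \<le> ?m' i"
        proof (cases "i = r \<and> i' \<noteq> r")
          case True
          then have "m i' \<le> m (Suc r)" using row_decreasingD[OF m, of "Suc r" i'] i by simp
          then show ?thesis using True corner by simp
        next
          case False
          then show ?thesis using row_decreasingD[OF m i] by auto
        qed
      qed
      have m_less: "(\<Sum>i = 1..n. ?m' i) < (\<Sum>i = 1..n. m i)"
        by (rule sum_strict_mono_ex1) (use r corner in auto)
      have IH2: "rpp_sum x y n ?m' c = flag_det x y n ?m' c"
        using m_less by (intro less.hyps m' c cn) simp_all
      show ?thesis
        using rpp_sum_split[OF m r(1,2) corner _ pre, of x y]
          flag_det_split[where m = m and c = c and r = r and y = y, OF inj r(1) rc] IH1 IH2 cr corner by simp
    qed
  qed
qed

section \<open>Excited diagrams\<close>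

definition shifted_cells :: "(nat \<times> nat) set \<Rightarrow> (nat \<times> nat \<Rightarrow> nat) \<Rightarrow> (nat \<times> nat) set" where
  "shifted_cells C k = (\<lambda>(i, j). (i + k (i, j), j + k (i, j))) ` C"

lemma mem_shifted_cells:
  "(a, b) \<in> shifted_cells C k \<longleftrightarrow> (\<exists>i j. (i, j) \<in> C \<and> a = i + k (i, j) \<and> b = j + k (i, j))"
  unfolding shifted_cells_def by auto

text \<open>Cells that land on one position share a diagonal, hence are comparable, and the
  southeast one moves at least as far.\<close>

lemma shift_inj:
  assumes k: "k \<in> bounded_rpp n m c" and p: "(i, j) \<in> cells n m" "(i', j') \<in> cells n m"
    and eq: "i + k (i, j) = i' + k (i', j')" "j + k (i, j) = j' + k (i', j')"
  shows "i = i' \<and> j = j'"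
proof (cases "i \<le> i'")
  case True
  then have "j \<le> j'" using eq by linarith
  then show ?thesis using bounded_rpp_mono[OF k p True] eq by linarith
next
  case False
  then have "i' \<le> i" "j' \<le> j" using eq by linarith+
  then show ?thesis using bounded_rpp_mono[OF k p(2,1)] eq by linarith
qed

lemma shift_inj_on:
  assumes "k \<in> bounded_rpp n m c"
  shows "inj_on (\<lambda>(i, j). (i + k (i, j), j + k (i, j))) (cells n m)"
  by (rule inj_onI) (use shift_inj[OF assms] in \<open>auto split: prod.splits\<close>)

text \<open>Positions increase strictly along each diagonal, so the rows above \<open>i\<close> determine the next one.\<close>

lemma shifted_cells_le:
  assumes k: "k \<in> bounded_rpp n m c" and h: "h \<in> bounded_rpp n m c'"
    and eq: "shifted_cells (cells n m) k = shifted_cells (cells n m) h"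
    and ij: "(i, j) \<in> cells n m"
    and IH: "\<And>i' j'. (i', j') \<in> cells n m \<Longrightarrow> i' < i \<Longrightarrow> k (i', j') = h (i', j')"
  shows "h (i, j) \<le> k (i, j)"
proof (rule ccontr)
  assume less: "\<not> ?thesis"
  have "(i + k (i, j), j + k (i, j)) \<in> shifted_cells (cells n m) h"
    using eq ij mem_shifted_cells by blast
  then obtain i' j' where p: "(i', j') \<in> cells n m"
    and e: "i + k (i, j) = i' + h (i', j')" "j + k (i, j) = j' + h (i', j')"
    unfolding mem_shifted_cells by blast
  show False
  proof (cases "i' < i")
    case True
    then show False using shift_inj[OF k ij p] IH[OF p True] e by simp
  next
    case False
    then have "i \<le> i'" "j \<le> j'" using e by linarith+
    then show False using bounded_rpp_mono[OF h ij p] less e by linarith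
  qed
qed

lemma shifted_cells_inj_on: "inj_on (shifted_cells (cells n m)) (bounded_rpp n m c)"
proof (rule inj_onI)
  fix k h assume k: "k \<in> bounded_rpp n m c" and h: "h \<in> bounded_rpp n m c"
    and eq: "shifted_cells (cells n m) k = shifted_cells (cells n m) h"
  have "(i, j) \<in> cells n m \<Longrightarrow> k (i, j) = h (i, j)" for i j
  proof (induction i arbitrary: j rule: less_induct)
    case (less i)
    show ?case
      by (rule antisym; rule shifted_cells_le[OF _ _ _ less.prems])
        (use k h eq less.IH in auto)
  qed
  then show "k = h"
    using bounded_rpp_outside[OF k] bounded_rpp_outside[OF h] by (metis ext surj_pair)
qed

lemma rpp_weight_eq_prod_shifted_cells:
  assumes "k \<in> bounded_rpp n m c"
  shows "rpp_weight x y (cells n m) k = (\<Prod>(i, j) \<in> shifted_cells (cells n m) k. x i - y j)"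
  unfolding shifted_cells_def rpp_weight_def prod.reindex[OF shift_inj_on[OF assms]]
  by (intro prod.cong) auto

lemma rpp_sum_eq_sum_shifted_cells:
  "rpp_sum x y n m c = (\<Sum>D \<in> shifted_cells (cells n m) ` bounded_rpp n m c. \<Prod>(i, j) \<in> D. x i - y j)"
  unfolding rpp_sum_def sum.reindex[OF shifted_cells_inj_on]
  by (intro sum.cong) (auto simp: rpp_weight_eq_prod_shifted_cells)

text \<open>An excitation is the increment of one entry. The shift is injective, so deleting the old
  position loses no other cell.\<close>

lemma shifted_cells_increment:
  assumes k: "k \<in> bounded_rpp n m c" and p: "(i, j) \<in> cells n m"
  shows "shifted_cells (cells n m) (k((i, j) := Suc (k (i, j)))) =
    insert (i + k (i, j) + 1, j + k (i, j) + 1)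
      (shifted_cells (cells n m) k - {(i + k (i, j), j + k (i, j))})" (is "?L = ?R")
proof -
  let ?f = "\<lambda>(i, j). (i + k (i, j), j + k (i, j))"
  have "?L = insert (i + k (i, j) + 1, j + k (i, j) + 1) (?f ` (cells n m - {(i, j)}))"
  proof -
    have "?L = shifted_cells (insert (i, j) (cells n m - {(i, j)})) (k((i, j) := Suc (k (i, j))))"
      using p by (simp add: insert_absorb)
    also have "\<dots> = insert (i + k (i, j) + 1, j + k (i, j) + 1)
        (shifted_cells (cells n m - {(i, j)}) (k((i, j) := Suc (k (i, j)))))"
      unfolding shifted_cells_def image_insert by simp
    also have "shifted_cells (cells n m - {(i, j)}) (k((i, j) := Suc (k (i, j))))
        = ?f ` (cells n m - {(i, j)})"
      unfolding shifted_cells_def by (rule image_cong) (auto split: if_splits)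
    finally show ?thesis .
  qed
  also have "?f ` (cells n m - {(i, j)}) = ?f ` cells n m - ?f ` {(i, j)}"
    by (rule inj_on_image_set_diff[OF shift_inj_on[OF k]]) (use p in auto)
  finally show ?thesis by (simp add: shifted_cells_def)
qed

section \<open>Excited diagrams in the outer shape as shifted shapes\<close>

definition parts :: "nat list \<Rightarrow> nat \<Rightarrow> nat" where
  "parts \<mu> i = (if 1 \<le> i \<and> i \<le> length \<mu> then \<mu> ! (i - 1) else 0)"

lemma row_decreasing_parts:
  assumes "is_partition \<mu>"
  shows "row_decreasing n (parts \<mu>)"
proof -
  have "\<mu> ! (i' - 1) \<le> \<mu> ! (i - 1)" if "1 \<le> i" "i \<le> i'" "i' \<le> length \<mu>" for i i'
    using assms that sorted_wrt_nth_less[of "(\<ge>)" \<mu> "i - 1" "i' - 1"]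
    unfolding is_partition_def by (cases "i = i'") auto
  then show ?thesis by (auto simp: row_decreasing_def parts_def)
qed

text \<open>\<open>parts\<close> is 0 beyond the last part, so the shape can be given as many rows
  as the determinant has, the extra ones empty.\<close>

lemma diagram_eq_cells: "length \<mu> \<le> n \<Longrightarrow> diagram \<mu> = cells n (parts \<mu>)"
  by (auto simp: diagram_def cells_def parts_def split: if_splits)

text \<open>With truncated subtraction, \<open>max 1 (a - d)\<close> is 1 on the \<open>d\<close>
  added rows and the original row index below them.\<close>

lemma mem_diagram_outer_shape:
  assumes "is_partition \<mu>" "length \<mu> \<ge> 1"
  shows "(a, b) \<in> diagram (outer_shape \<mu> d) \<longleftrightarrow>
    1 \<le> a \<and> a \<le> d + length \<mu> \<and> 1 \<le> b \<and> b \<le> parts \<mu> (max 1 (a - d)) + d"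
proof -
  have "outer_shape \<mu> d ! (a - 1) = parts \<mu> (max 1 (a - d)) + d" if "1 \<le> a" "a \<le> d + length \<mu>"
  proof (cases "a \<le> d")
    case True
    then show ?thesis using that assms(2) by (simp add: outer_shape_def nth_append parts_def)
  next
    case False
    then have "a - 1 - d < length \<mu>" "max 1 (a - d) = a - d" "a - 1 - d = a - d - 1" "\<not> a - 1 < d"
      "1 \<le> a - d" "a - d \<le> length \<mu>"
      using that by auto
    then show ?thesis using that False by (simp add: outer_shape_def nth_append parts_def)
  qed
  then show ?thesis by (auto simp: diagram_def outer_shape_def)
qed

text \<open>Excitations increment an entry and stay within the bounded fillings; conversely a
  filling is reduced to 0 by undoing them, by induction on the sum of its entries. Rows below \<mu>
  are empty, so \<open>c\<close> is left free there.\<close>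

lemma excited_diagrams_eq_shifted_cells:
  fixes \<mu> :: "nat list" and d :: nat
  assumes \<mu>: "is_partition \<mu>" "length \<mu> \<ge> 1"
  defines "n \<equiv> d + length \<mu>"
  assumes c: "\<And>i. 1 \<le> i \<Longrightarrow> i \<le> length \<mu> \<Longrightarrow> c i = d"
  shows "excited_diagrams (outer_shape \<mu> d) \<mu> =
    shifted_cells (cells n (parts \<mu>)) ` bounded_rpp n (parts \<mu>) c" (is "?E = shifted_cells ?C ` ?P")
proof
  have dec: "row_decreasing n (parts \<mu>)" for n by (rule row_decreasing_parts[OF \<mu>(1)])
  have D0: "diagram \<mu> = ?C" by (rule diagram_eq_cells) (simp add: n_def)
  have zero: "(\<lambda>p. 0) \<in> ?P" by (rule bounded_rppI) auto
  have shift0: "shifted_cells ?C (\<lambda>p. 0) = ?C" by (auto simp: shifted_cells_def)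
  have row: "1 \<le> i \<and> i \<le> length \<mu> \<and> 1 \<le> j \<and> j \<le> parts \<mu> i" if "(i, j) \<in> ?C" for i j
    using that by (auto simp: cells_def parts_def split: if_splits)
  have bound: "k (i, j) \<le> d" if "k \<in> ?P" "(i, j) \<in> ?C" for k i j
    using bounded_rpp_le[OF that] c[of i] row[OF that(2)] by simp
  note outer = mem_diagram_outer_shape[OF \<mu>, of _ _ d]
  show "?E \<subseteq> shifted_cells ?C ` ?P"
  proof
    fix D assume "D \<in> ?E"
    then show "D \<in> shifted_cells ?C ` ?P"
    proof induction
      case base
      then show ?case using zero shift0 D0 by (metis image_eqI)
    next
      case (excite D a b)
      then obtain k where k: "k \<in> ?P" and D: "D = shifted_cells ?C k" by blast
      obtain i j where p: "(i, j) \<in> ?C" and a: "a = i + k (i, j)" and b: "b = j + k (i, j)"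
        using excite.hyps(2) unfolding D mem_shifted_cells by blast
      let ?k' = "k((i, j) := Suc (k (i, j)))"
      have free: "(a, b + 1) \<notin> D" "(a + 1, b) \<notin> D"
        and room: "(a + 1, b + 1) \<in> diagram (outer_shape \<mu> d)"
        using excite.hyps(3) by auto
      \<comment> \<open>A right neighbour with the same entry would occupy
        \<open>(a, b + 1)\<close>, which has to be free; likewise for the lower neighbour.\<close>
      have right: "k (i, j) < k (i, Suc j)" if q: "(i, Suc j) \<in> ?C"
      proof (rule ccontr)
        assume "\<not> ?thesis"
        then have "k (i, Suc j) = k (i, j)" using bounded_rpp_mono[OF k p q] by simp
        then have "(a, b + 1) \<in> D" unfolding D mem_shifted_cells using q a b by force
        then show False using free by blast
      qed
      have down: "k (i, j) < k (Suc i, j)" if q: "(Suc i, j) \<in> ?C"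
      proof (rule ccontr)
        assume "\<not> ?thesis"
        then have "k (Suc i, j) = k (i, j)" using bounded_rpp_mono[OF k p q] by simp
        then have "(a + 1, b) \<in> D" unfolding D mem_shifted_cells using q a b by force
        then show False using free by blast
      qed
      \<comment> \<open>Any other cell weakly southeast of \<open>(i, j)\<close> is weakly southeast
        of its right or lower neighbour, so the increment keeps monotonicity.\<close>
      have above: "k (i, j) < k (i', j')"
        if q: "(i', j') \<in> ?C" "i \<le> i'" "j \<le> j'" "(i', j') \<noteq> (i, j)" for i' j'
      proof (cases "j < j'")
        case True
        then have "(i, Suc j) \<in> ?C"
          using cells_down_closed[OF dec q(1), of i "Suc j"] q row[OF p] by simp
        then show ?thesis
          using right bounded_rpp_mono[OF k, of i "Suc j" i' j'] q True by fastforce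
      next
        case False
        then have "i < i'" using q by auto
        then have "(Suc i, j) \<in> ?C"
          using cells_down_closed[OF dec q(1), of "Suc i" j] q row[OF p] by simp
        then show ?thesis
          using down bounded_rpp_mono[OF k, of "Suc i" j i' j'] q \<open>i < i'\<close> by fastforce
      qed
      have less: "k (i, j) < d"
      proof (cases "(i, Suc j) \<in> ?C")
        case True
        then show ?thesis using right[OF True] bound[OF k True] by simp
      next
        case False
        then have j: "j = parts \<mu> i" using row[OF p] p by (auto simp: cells_def)
        \<comment> \<open>From the end of row \<open>i\<close> with entry \<open>d\<close>, the move
          stays in the outer shape only if row \<open>Suc i\<close> of \<mu> is longer than row
          \<open>i\<close>.\<close>
        show ?thesis
        proof (rule ccontr)
          assume "\<not> ?thesis"
          then have kd: "k (i, j) = d" using bound[OF k p] by simp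
          have "Suc i \<le> length \<mu>" "Suc (parts \<mu> i) \<le> parts \<mu> (Suc i)"
            using room row[OF p] unfolding outer a b kd by (auto simp: j)
          then show False
            using row_decreasingD[OF dec, of i "Suc i" "length \<mu>"] row[OF p] by simp
        qed
      qed
      have "?k' \<in> ?P"
      proof (rule bounded_rppI)
        fix q assume "q \<notin> ?C"
        then show "?k' q = 0" using bounded_rpp_outside[OF k] p by auto
      next
        fix i1 j1 i2 j2 assume q: "(i1, j1) \<in> ?C" "(i2, j2) \<in> ?C" "i1 \<le> i2" "j1 \<le> j2"
        show "?k' (i1, j1) \<le> ?k' (i2, j2)"
          using bounded_rpp_mono[OF k q] above[of i2 j2] q by auto
      next
        fix i1 j1 assume q: "(i1, j1) \<in> ?C"
        show "?k' (i1, j1) \<le> c i1"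
          using bounded_rpp_le[OF k q] less c[of i] row[OF p] by auto
      qed
      then show ?case
        using shifted_cells_increment[OF k p] unfolding D a b by (metis image_eqI)
    qed
  qed
  show "shifted_cells ?C ` ?P \<subseteq> ?E"
  proof
    fix D assume "D \<in> shifted_cells ?C ` ?P"
    then obtain k where "k \<in> ?P" "D = shifted_cells ?C k" by blast
    moreover have "shifted_cells ?C k \<in> ?E" if "k \<in> ?P" for k
      using that
    proof (induction "\<Sum>p \<in> ?C. k p" arbitrary: k rule: less_induct)
      case (less k)
      note k = less.prems
      show ?case
      proof (cases "\<exists>s i j. s = i + j \<and> (i, j) \<in> ?C \<and> 0 < k (i, j)")
        case False
        then have "k = (\<lambda>p. 0)" using bounded_rpp_outside[OF k] by (metis ext gr0I surj_pair)
        then show ?thesis using shift0 D0 excited_diagrams.base by metis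
      next
        case True
        \<comment> \<open>Undo an excitation at a nonzero cell on the lowest antidiagonal: all smaller cells are still at rest.\<close>
        define s where "s = (LEAST s. \<exists>i j. s = i + j \<and> (i, j) \<in> ?C \<and> 0 < k (i, j))"
        obtain i j where s: "s = i + j" and p: "(i, j) \<in> ?C" and pos: "0 < k (i, j)"
          using LeastI_ex[OF True] unfolding s_def by blast
        have min: "k (i', j') = 0" if "(i', j') \<in> ?C" "i' + j' < i + j" for i' j'
        proof -
          have "\<not> (\<exists>i j. i' + j' = i + j \<and> (i, j) \<in> ?C \<and> 0 < k (i, j))"
            by (rule not_less_Least) (use that(2) s in \<open>simp add: s_def\<close>)
          then show ?thesis using that(1) by auto
        qed
        define h where "h = k((i, j) := k (i, j) - 1)"
        have hk: "h q = k q" if "q \<noteq> (i, j)" for q using that by (simp add: h_def)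
        have hp: "Suc (h (i, j)) = k (i, j)" using pos by (simp add: h_def)
        have hP: "h \<in> ?P"
        proof (rule bounded_rppI)
          fix q assume "q \<notin> ?C"
          then show "h q = 0" using bounded_rpp_outside[OF k] p hk by metis
        next
          fix i1 j1 i2 j2 assume q: "(i1, j1) \<in> ?C" "(i2, j2) \<in> ?C" "i1 \<le> i2" "j1 \<le> j2"
          show "h (i1, j1) \<le> h (i2, j2)"
          \<comment> \<open>Only comparisons with the decreased entry on the right are critical;
            there the left entry lies on a lower antidiagonal and is 0.\<close>
          proof (cases "(i2, j2) = (i, j) \<and> (i1, j1) \<noteq> (i, j)")
            case True
            then have "i1 + j1 < i + j" using q by auto
            then show ?thesis using min[OF q(1)] hk True by simp
          next
            case False
            then show ?thesis using bounded_rpp_mono[OF k q] by (auto simp: h_def)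
          qed
        next
          fix i1 j1 assume q: "(i1, j1) \<in> ?C"
          show "h (i1, j1) \<le> c i1"
            using bounded_rpp_le[OF k q] by (auto simp: h_def)
        qed
        have "(\<Sum>p \<in> ?C. h p) < (\<Sum>p \<in> ?C. k p)"
          by (rule sum_strict_mono_ex1) (use p pos finite_cells in \<open>auto simp: h_def\<close>)
        then have IH: "shifted_cells ?C h \<in> ?E" using less.hyps hP by blast
        let ?a = "i + h (i, j)" and ?b = "j + h (i, j)"
        have mem: "(?a, ?b) \<in> shifted_cells ?C h" unfolding mem_shifted_cells using p by blast
        have bd: "Suc (h (i, j)) \<le> d" using bound[OF k p] hp by simp
        have free: "(?a + e, ?b + f) \<notin> shifted_cells ?C h"
          if ef: "e \<le> 1" "f \<le> 1" "e + f \<ge> 1" for e f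
        proof
          assume "(?a + e, ?b + f) \<in> shifted_cells ?C h"
          then obtain i1 j1 where q: "(i1, j1) \<in> ?C"
            and eq: "?a + e = i1 + h (i1, j1)" "?b + f = j1 + h (i1, j1)"
            unfolding mem_shifted_cells by blast
          \<comment> \<open>The diagonals differ by at most one, which excludes cells strictly
            northeast or southwest. A cell on a lower antidiagonal is at rest and falls short;
            another cell to the southeast overshoots.\<close>
          have "j1 + i + e = i1 + j + f" using eq by linarith
          then consider "(i1, j1) = (i, j)" | "i1 + j1 < i + j" | "i \<le> i1" "j \<le> j1" "(i1, j1) \<noteq> (i, j)"
            using ef by (cases "i \<le> i1"; cases "j \<le> j1") force+
          then show False
          proof cases
            case 1
            then show False using eq ef by simp
          next
            case 2
            then have "h (i1, j1) = 0" using min[OF q] hk[of "(i1, j1)"] by auto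
            then show False using eq ef 2 by linarith
          next
            case 3
            then have "k (i, j) \<le> h (i1, j1)" using bounded_rpp_mono[OF k p q] hk by metis
            then show False using eq ef hp 3 by simp
          qed
        qed
        have "{(?a + 1, ?b), (?a, ?b + 1), (?a + 1, ?b + 1)} \<subseteq> diagram (outer_shape \<mu> d)"
        proof -
          \<comment> \<open>As the parts decrease, the outer shape contains all positions up to row
            \<open>i + d\<close> and column \<open>j + d\<close>.\<close>
          have "parts \<mu> i \<le> parts \<mu> (max 1 (a - d))" if "a \<le> i + d" for a
            using row_decreasingD[OF dec, of "max 1 (a - d)" i "length \<mu>"] that row[OF p] by auto
          then have "(a, b) \<in> diagram (outer_shape \<mu> d)"
            if "1 \<le> a" "1 \<le> b" "a \<le> i + d" "b \<le> j + d" for a b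
            using that row[OF p] unfolding outer by (fastforce intro: order_trans)
          then show ?thesis using bd row[OF p] by auto
        qed
        then have "{(?a + 1, ?b), (?a, ?b + 1), (?a + 1, ?b + 1)} \<subseteq>
            diagram (outer_shape \<mu> d) - shifted_cells ?C h"
          using free[of 1 0] free[of 0 1] free[of 1 1] by auto
        from excited_diagrams.excite[OF IH mem this]
        have "shifted_cells ?C (h((i, j) := Suc (h (i, j)))) \<in> ?E"
          unfolding shifted_cells_increment[OF hP p] .
        moreover have "h((i, j) := Suc (h (i, j))) = k" using hp by (auto simp: h_def)
        ultimately show ?thesis by simp
      qed
    qed
    ultimately show "D \<in> ?E" by blast
  qed
qed

section \<open>Specialization to the matrix of the theorem\<close>

lemma A_entry_eq_flag_entry:
  assumes "1 \<le> i" "i \<le> d + length \<mu>" "1 \<le> j" "j \<le> d + length \<mu>"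
  defines "c \<equiv> if j \<le> length \<mu> then d else d + length \<mu> - j"
  shows "A_entry x y \<mu> d i j = flag_entry x y (parts \<mu> j + c) (j + c) i"
  \<comment> \<open>For \<open>j > length \<mu>\<close> the part is 0 and
    \<open>j + c = d + length \<mu>\<close>, so the zero case of \<open>flag_entry\<close> does not
    occur.\<close>
  using assms by (auto simp: A_entry_def flag_entry_def parts_def Let_def add.commute)

theorem theorem7p6:
  fixes x y :: "nat \<Rightarrow> 'a::field" and \<mu> :: "nat list" and l d :: nat
  assumes "is_partition \<mu>" and "length \<mu> = l" and "l \<ge> 1"
    and "inj_on x {1..d + l}"
  shows "(\<Sum>D \<in> excited_diagrams (outer_shape \<mu> d) \<mu>. \<Prod>(i, j) \<in> D. x i - y j)
    = det (mat (d + l) (d + l) (\<lambda>(i, j). A_entry x y \<mu> d (i + 1) (j + 1)))"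
proof -
  \<comment> \<open>The bound is \<open>d\<close> on the rows of \<mu> and then falls by one in each
    of the \<open>d\<close> empty rows, to reach 0 at \<open>d + l\<close>.\<close>
  define c where "c j = (if j \<le> l then d else d + l - j)" for j
  have "(\<Sum>D \<in> excited_diagrams (outer_shape \<mu> d) \<mu>. \<Prod>(i, j) \<in> D. x i - y j)
      = rpp_sum x y (d + l) (parts \<mu>) c"
    using excited_diagrams_eq_shifted_cells[of \<mu> c d] assms(1-3)
    by (simp add: rpp_sum_eq_sum_shifted_cells c_def)
  also have "\<dots> = flag_det x y (d + l) (parts \<mu>) c"
    by (rule rpp_sum_eq_flag_det[OF assms(4) row_decreasing_parts[OF assms(1)]])
      (auto simp: c_def)
  also have "\<dots> = det (mat (d + l) (d + l) (\<lambda>(i, j). A_entry x y \<mu> d (i + 1) (j + 1)))"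
    unfolding flag_det_def using assms(2)
    by (intro arg_cong[where f = det] eq_matI) (auto simp: A_entry_eq_flag_entry c_def)
  finally show ?thesis .
qed

end
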